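(* For every positive integer $n$, the unsigned Genocchi number $|G_{2n+2}|$ equals the number of sequences $$R_1,C_1,R_2,C_2,\dots,R_m,C_m,R_{m+1}$$ (where $m$ is an arbitrary nonnegative integer) such that \begin{itemize} \item $\{R_1,\dots,R_{m+1}\}$ is a partition of $\{1,3,5,\dots,2n+1\}$ into $m+1$ nonempty sets, \item $\{C_1,\dots,C_m\}$ is a partition of $\{2,4,6,\dots,2n\}$ into $m$ nonempty sets, and \item $\max R_i<\min C_i$ for all $i=1,\dots,m$. \end{itemize}
   Context: The unsigned Genocchi number $|G_{2n+2}|$ is defined combinatorially as the number of permutations $\alpha=a_1a_2\dots a_{2n+1}$ of $\{1,\dots,2n+1\}$ such that $a_{2n+1}=2n+1$, $A(\alpha)=\{1,3,\dots,2n-1\}$ and $D(\alpha)=\{2,4,\dots,2n\}$, where $A(\alpha)$ is the set of ascent bottoms (elements $a_i$ with $i\le 2n$ and $a_i<a_{i+1}$) and $D(\alpha)$ is the set of descent tops (elements $a_i$ with $i\le 2n$ and $a_i>a_{i+1}$). *)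

theory Defs
  imports "HOL-Combinatorics.Multiset_Permutations" "HOL-Library.Disjoint_Sets"
begin

definition ascent_bottoms :: "nat list \<Rightarrow> nat set" where
  "ascent_bottoms xs = {xs ! i | i. Suc i < length xs \<and> xs ! i < xs ! Suc i}"

definition descent_tops :: "nat list \<Rightarrow> nat set" where
  "descent_tops xs = {xs ! i | i. Suc i < length xs \<and> xs ! i > xs ! Suc i}"

text \<open>Permutations are words, i.e. lists containing each element of the ground set exactly once.\<close>

definition genocchi_perms :: "nat \<Rightarrow> nat list set" where
  "genocchi_perms n =
    {xs \<in> permutations_of_set {1..2 * n + 1}.
       last xs = 2 * n + 1 \<and>
       ascent_bottoms xs = {k \<in> {1..2 * n}. odd k} \<and>
       descent_tops xs = {k \<in> {1..2 * n}. even k}}"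

text \<open>The argument \<open>n\<close> corresponds to the index \<open>2n + 2\<close>:
  \<open>unsigned_genocchi n\<close> is $|G_{2n+2}|$.\<close>

definition unsigned_genocchi :: "nat \<Rightarrow> nat" where
  "unsigned_genocchi n = card (genocchi_perms n)"

text \<open>A sequence $R_1, C_1, \ldots, R_m, C_m, R_{m+1}$ is encoded as the pair of lists
  \<open>Rs\<close> = $[R_1, \ldots, R_{m+1}]$ and \<open>Cs\<close> = $[C_1, \ldots, C_m]$, indexed from \<open>0\<close>;
  \<open>m\<close> is the length of \<open>Cs\<close>.
  As \<^const>\<open>partition_on\<close> speaks about sets of blocks,
  distinctness of the lists is needed to make the number of blocks \<open>m + 1\<close> and \<open>m\<close>.\<close>

definition genocchi_block_seqs :: "nat \<Rightarrow> (nat set list \<times> nat set list) set" where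
  "genocchi_block_seqs n =
    {(Rs, Cs).
       length Rs = length Cs + 1 \<and>
       distinct Rs \<and> partition_on {k \<in> {1..2 * n + 1}. odd k} (set Rs) \<and>
       distinct Cs \<and> partition_on {k \<in> {1..2 * n}. even k} (set Cs) \<and>
       (\<forall>i < length Cs. Max (Rs ! i) < Min (Cs ! i))}"

text \<open>Both sets are finite, so their \<^const>\<open>card\<close> is the actual number of elements.\<close>

lemma finite_genocchi_perms: "finite (genocchi_perms n)"
  unfolding genocchi_perms_def by simp

lemma finite_genocchi_block_seqs: "finite (genocchi_block_seqs n)"
proof -
  have fin: "finite {xs. distinct xs \<and> set xs \<subseteq> Pow A}" if "finite A" for A :: "nat set"
    using finite_subset_distinct[of "Pow A"] that by (simp add: conj_commute)
  let ?O = "{k \<in> {1..2 * n + 1}. odd k}" and ?E = "{k \<in> {1..2 * n}. even k}"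
  have "genocchi_block_seqs n \<subseteq>
      {xs. distinct xs \<and> set xs \<subseteq> Pow ?O} \<times> {xs. distinct xs \<and> set xs \<subseteq> Pow ?E}"
    unfolding genocchi_block_seqs_def partition_on_def by blast
  then show ?thesis
    by (rule finite_subset) (intro finite_cartesian_product fin; simp)
qed

end

theory Submission
  imports Defs
begin

text \<open>
  Let \<open>A\<close> be the set of odd numbers below \<open>2n + 1\<close>. Both sides count permutations
  of \<open>{1..2n}\<close>, followed by \<open>2n + 1\<close>, subject to a condition on neighbouring letters \<open>x y\<close>.
  On the Genocchi side the step is an ascent precisely when \<open>x \<in> A\<close>. On the other side a block sequence
  is written out as a word, every block in increasing order; this gives the words starting with
  an odd letter in which every descent goes from an even letter to an odd one.

  Both conditions make sense for any finite ground set of numbers and any subset \<open>A\<close>, and in this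
  generality both numbers \<open>f(S, A)\<close> satisfy the recurrence
  \<open>f(S, A) = f(S, A - {k} \<union> {l}) + f(S - {l}, A) + f(S - {l}, A - {k})\<close>
  for neighbouring elements \<open>k < l\<close> of \<open>S\<close> with \<open>k \<in> A\<close> and \<open>l \<notin> A\<close>
  (\<open>card_tours_ascends_exactly_from_swap\<close>, \<open>card_tours_ascent_or_drop_swap\<close>).
  The first summand counts the words in which \<open>k\<close> and \<open>l\<close> can exchange their roles; in the remaining ones
  \<open>k\<close> and \<open>l\<close> are adjacent and are fused into one letter (\<open>card_tours_delete_contract\<close>).
  On the Genocchi side the orders \<open>k l\<close> and \<open>l k\<close> give a letter outside \<open>A\<close> and one in \<open>A\<close>.
  On the other side only \<open>k l\<close> is to be fused, and the result is a letter with the freedom of both types;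
  that these words are nevertheless counted by the sum over the two types rests on the fact that
  a word that begins and ends high passes a given level upwards as often as downwards
  (\<open>card_tours_flexible_letter\<close>). The recurrence and the trivial cases determine \<open>f\<close>, whence the equality
  (\<open>card_tours_ascends_exactly_from_eq\<close>).
\<close>

section \<open>Words with prescribed steps: deletion and contraction\<close>

text \<open>The letter \<open>N\<close> stands at both ends, so that a tour is a Hamiltonian cycle through \<open>N\<close> cut
  open there, and \<open>P\<close> also constrains the first and the last letter of the word.
  In the application \<open>N\<close> is the final letter \<open>2n + 1\<close>, and the copy in front makes the number of
  upward passages of the word over a level equal to the number of downward passages.\<close>

definition tours :: "'a \<Rightarrow> 'a set \<Rightarrow> ('a \<Rightarrow> 'a \<Rightarrow> bool) \<Rightarrow> 'a list set" where
  "tours N S P = {w \<in> permutations_of_set S. successively P (N # w @ [N])}"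

lemma finite_tours [simp]: "finite (tours N S P)"
  unfolding tours_def by simp

text \<open>A nonempty tour never steps from a letter to itself, so \<open>P\<close> matters off the diagonal only.
  The empty word is different: it makes the single step from \<open>N\<close> to \<open>N\<close>.\<close>

lemma tours_cong:
  assumes "S \<noteq> {}" "N \<notin> S"
    and eq: "\<And>x y. x \<in> insert N S \<Longrightarrow> y \<in> insert N S \<Longrightarrow> x \<noteq> y \<Longrightarrow> P x y \<longleftrightarrow> Q x y"
  shows "tours N S P = tours N S Q"
proof -
  have "successively P (N # w @ [N]) \<longleftrightarrow> successively Q (N # w @ [N])"
    if w: "w \<in> permutations_of_set S" for w
  proof -
    let ?L = "N # w @ [N]"
    have set: "set w = S" "distinct w" and ne: "w \<noteq> []"
      using w assms(1) by (auto simp: permutations_of_set_def)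
    have "successively (\<noteq>) w"
      using set by (auto simp: successively_conv_nth nth_eq_iff_index_eq)
    then have neq: "successively (\<noteq>) ?L"
      using set ne assms(2) hd_in_set[of w] last_in_set[of w]
      by (auto simp: successively_Cons successively_append_iff)
    have "P (?L ! i) (?L ! Suc i) \<longleftrightarrow> Q (?L ! i) (?L ! Suc i)" if "Suc i < length ?L" for i
    proof (rule eq)
      show "?L ! i \<noteq> ?L ! Suc i"
        using neq that by (auto simp: successively_conv_nth)
      have "?L ! i \<in> set ?L" "?L ! Suc i \<in> set ?L"
        using that by (intro nth_mem; simp)+
      then show "?L ! i \<in> insert N S" "?L ! Suc i \<in> insert N S"
        using set by auto
    qed
    then show ?thesis by (auto simp: successively_conv_nth)
  qed
  then show ?thesis unfolding tours_def by blast
qed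

lemma card_tours_relabel:
  assumes inj: "inj_on f (insert N S)" and "f N = N"
    and eq: "\<And>x y. x \<in> insert N S \<Longrightarrow> y \<in> insert N S \<Longrightarrow> P x y \<longleftrightarrow> Q (f x) (f y)"
  shows "card (tours N S P) = card (tours N (f ` S) Q)"
proof -
  have injS: "inj_on f S" using inj by (auto intro: inj_on_subset)
  have succ: "successively P (N # w @ [N]) \<longleftrightarrow> successively Q (N # map f w @ [N])"
    if "set w = S" for w
  proof -
    have "successively Q (N # map f w @ [N]) \<longleftrightarrow> successively Q (map f (N # w @ [N]))"
      using assms(2) by simp
    also have "\<dots> \<longleftrightarrow> successively P (N # w @ [N])"
      unfolding successively_map
      by (rule successively_cong) (use eq that in auto)
    finally show ?thesis by simp
  qed
  have "tours N (f ` S) Q = map f ` tours N S P"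
    unfolding tours_def permutations_of_set_image_inj[OF injS]
    using succ by (auto simp: permutations_of_set_def)
  moreover have "inj_on (map f) (tours N S P)"
    by (rule inj_onI) (use injS in \<open>auto simp: tours_def permutations_of_set_def inj_on_map_eq_map\<close>)
  ultimately show ?thesis by (simp add: card_image)
qed

lemma successively_neq_pair_iff:
  "successively (\<lambda>x y. (x, y) \<noteq> (a, b)) w \<longleftrightarrow> \<not> (\<exists>us vs. w = us @ a # b # vs)"
proof
  show "successively (\<lambda>x y. (x, y) \<noteq> (a, b)) w \<Longrightarrow> \<not> (\<exists>us vs. w = us @ a # b # vs)"
    by (auto simp: successively_append_iff)
next
  assume no: "\<not> (\<exists>us vs. w = us @ a # b # vs)"
  show "successively (\<lambda>x y. (x, y) \<noteq> (a, b)) w"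
    unfolding successively_conv_nth
  proof (intro allI impI notI)
    fix i assume i: "Suc i < length w" "(w ! i, w ! Suc i) = (a, b)"
    then have "w = take i w @ a # b # drop (Suc (Suc i)) w"
      by (metis Cons_nth_drop_Suc Suc_lessD append_take_drop_id prod.inject)
    with no show False by blast
  qed
qed

lemma successively_conj:
  "successively (\<lambda>x y. P x y \<and> Q x y) w \<longleftrightarrow> successively P w \<and> successively Q w"
  by (auto simp: successively_conv_nth)

lemma split_at_letter:
  assumes "w \<in> permutations_of_set S" "c \<in> S"
  obtains us vs where "w = us @ c # vs" "c \<notin> set us" "c \<notin> set vs"
    "distinct us" "distinct vs" "set us \<inter> set vs = {}" "set us \<union> set vs = S - {c}"
proof -
  have "c \<in> set w" using assms by (simp add: permutations_of_set_def)
  then obtain us vs where w: "w = us @ c # vs" by (auto dest: split_list)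
  show thesis by (rule that[OF w]) (use assms w in \<open>auto simp: permutations_of_set_def\<close>)
qed

text \<open>Deletion and contraction of the edge from \<open>a\<close> to \<open>b\<close> in the digraph \<open>P\<close>: a tour either avoids the
  edge, or it contains the factor \<open>a b\<close>, which can be fused into one letter \<open>c\<close> that is entered
  like \<open>a\<close> and left like \<open>b\<close>. The name \<open>c\<close> may be \<open>a\<close> or \<open>b\<close> itself, so that
  opposite edges can be contracted to the same letter.\<close>

lemma card_tours_delete_contract:
  assumes ab: "a \<in> S" "b \<in> S" "a \<noteq> b" "P a b" and N: "N \<notin> S"
    and c: "c \<notin> S - {a, b}" "c \<noteq> N"
  shows "card (tours N S P) =
    card (tours N S (\<lambda>x y. P x y \<and> (x, y) \<noteq> (a, b))) +
    card (tours N (insert c (S - {a, b}))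
      (\<lambda>x y. P (if x = c then b else x) (if y = c then a else y)))"
    (is "_ = card ?D + card (tours N ?S ?Q)")
proof -
  define T where "T = {w \<in> tours N S P. \<exists>us vs. w = us @ a # b # vs}"
  have aN: "a \<noteq> N" "b \<noteq> N" using ab N by auto
  have "(\<exists>us vs. N # w @ [N] = us @ a # b # vs) \<longleftrightarrow> (\<exists>us vs. w = us @ a # b # vs)" for w
  proof
    assume "\<exists>us vs. N # w @ [N] = us @ a # b # vs"
    then obtain us vs where eq: "N # w @ [N] = us @ a # b # vs" by blast
    then obtain us' where us: "us = N # us'" using aN by (cases us) auto
    then obtain vs' where "vs = vs' @ [N]" using eq aN by (cases vs rule: rev_cases) auto
    then show "\<exists>us vs. w = us @ a # b # vs" using eq us by auto
  next
    assume "\<exists>us vs. w = us @ a # b # vs"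
    then show "\<exists>us vs. N # w @ [N] = us @ a # b # vs"
      by (metis append_Cons append_assoc)
  qed
  then have D: "?D = tours N S P - T"
    unfolding tours_def T_def successively_conj successively_neq_pair_iff by auto
  have T_sub: "T \<subseteq> tours N S P" unfolding T_def by auto

  \<comment> \<open>the inverse of the fusion\<close>
  define g where "g = (\<lambda>w. concat (map (\<lambda>x. if x = c then [a, b] else [x]) w))"
  have g_id: "g us = us" if "c \<notin> set us" for us
    using that by (induction us) (auto simp: g_def)
  have g_split: "g (us @ c # vs) = us @ a # b # vs" if "c \<notin> set us" "c \<notin> set vs" for us vs
    using g_id[OF that(1)] g_id[OF that(2)] by (simp add: g_def)
  have succ: "successively P (N # us @ a # b # vs @ [N]) \<longleftrightarrow>
      successively ?Q (N # us @ c # vs @ [N])"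
    if "set us \<union> set vs = S - {a, b}" for us vs
  proof -
    have cn: "c \<notin> set (N # us)" "c \<notin> set (vs @ [N])" using that c by auto
    have eq: "successively ?Q xs \<longleftrightarrow> successively P xs" if "c \<notin> set xs" for xs
      by (rule successively_cong) (use that in auto)
    have "successively ?Q ((N # us) @ [c] @ (vs @ [N])) \<longleftrightarrow>
        successively ?Q (N # us) \<and> successively ?Q (vs @ [N]) \<and>
        ?Q (last (N # us)) c \<and> ?Q c (hd (vs @ [N]))"
      by (subst successively_append_iff, subst successively_append_iff) auto
    moreover have "last (N # us) \<noteq> c" using cn last_in_set[of "N # us"] by auto
    moreover have "hd (vs @ [N]) \<noteq> c" using cn hd_in_set[of "vs @ [N]"] by auto
    ultimately have 1: "successively ?Q ((N # us) @ [c] @ (vs @ [N])) \<longleftrightarrow>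
        successively P (N # us) \<and> successively P (vs @ [N]) \<and>
        P (last (N # us)) a \<and> P b (hd (vs @ [N]))"
      using eq[OF cn(1)] eq[OF cn(2)] \<open>last (N # us) \<noteq> c\<close> \<open>hd (vs @ [N]) \<noteq> c\<close> by auto
    have 2: "successively P ((N # us) @ [a, b] @ (vs @ [N])) \<longleftrightarrow>
        successively P (N # us) \<and> successively P (vs @ [N]) \<and>
        P (last (N # us)) a \<and> P b (hd (vs @ [N]))"
      by (subst successively_append_iff, subst successively_append_iff) (use ab in auto)
    show ?thesis using 1 2 by simp
  qed
  have "bij_betw g (tours N ?S ?Q) T"
    unfolding bij_betw_def
  proof
    show "inj_on g (tours N ?S ?Q)"
    proof (rule inj_onI)
      fix w w' assume w: "w \<in> tours N ?S ?Q" "w' \<in> tours N ?S ?Q" and eq: "g w = g w'"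
      have "w \<in> permutations_of_set ?S" "w' \<in> permutations_of_set ?S"
        using w by (auto simp: tours_def)
      from split_at_letter[OF this(1) insertI1] obtain us vs where
        s: "w = us @ c # vs" "c \<notin> set us" "c \<notin> set vs" "set us \<union> set vs = ?S - {c}"
        by metis
      from split_at_letter[OF \<open>w' \<in> permutations_of_set ?S\<close> insertI1] obtain us' vs' where
        s': "w' = us' @ c # vs'" "c \<notin> set us'" "c \<notin> set vs'" "set us' \<union> set vs' = ?S - {c}"
        by metis
      have "us @ a # b # vs = us' @ a # b # vs'"
        using eq s s' by (simp add: g_split)
      moreover have "a \<notin> set us" "a \<notin> set us'" using s s' by auto
      moreover have "a \<notin> set (b # vs)" "a \<notin> set (b # vs')" using s s' ab by auto
      ultimately have "us = us' \<and> b # vs = b # vs'" using append_Cons_eq_iff by metis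
      then show "w = w'" using s(1) s'(1) by simp
    qed
    show "g ` tours N ?S ?Q = T"
    proof (intro equalityI subsetI)
      fix v assume "v \<in> g ` tours N ?S ?Q"
      then obtain w where w: "w \<in> tours N ?S ?Q" "v = g w" by auto
      then have "w \<in> permutations_of_set ?S" by (simp add: tours_def)
      then obtain us vs where s: "w = us @ c # vs" "c \<notin> set us" "c \<notin> set vs"
        "distinct us" "distinct vs" "set us \<inter> set vs = {}" "set us \<union> set vs = ?S - {c}"
        by (rule split_at_letter) auto
      have set: "set us \<union> set vs = S - {a, b}" using s(7) c by auto
      have v: "v = us @ a # b # vs" using w s by (simp add: g_split)
      have "successively ?Q (N # us @ c # vs @ [N])" using w s by (simp add: tours_def)
      then have "successively P (N # v @ [N])" using succ[OF set] v by simp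
      moreover have "v \<in> permutations_of_set S"
        using v s(4-6) set ab by (auto simp: permutations_of_set_def)
      ultimately show "v \<in> T" using v by (auto simp: T_def tours_def)
    next
      fix v assume "v \<in> T"
      then obtain us vs where v: "v = us @ a # b # vs" "v \<in> permutations_of_set S"
        "successively P (N # v @ [N])" by (auto simp: T_def tours_def)
      then have set: "set us \<union> set vs = S - {a, b}" and
        d: "distinct us" "distinct vs" "set us \<inter> set vs = {}"
        by (auto simp: permutations_of_set_def)
      have cn: "c \<notin> set us" "c \<notin> set vs" using set c by auto
      have "us @ c # vs \<in> tours N ?S ?Q"
        using succ[OF set] v d set cn by (auto simp: tours_def permutations_of_set_def)
      then show "v \<in> g ` tours N ?S ?Q"
        unfolding v(1) g_split[OF cn, symmetric] by (rule imageI)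
    qed
  qed
  then have "card (tours N ?S ?Q) = card T" by (rule bij_betw_same_card)
  moreover have "card (tours N S P) = card ?D + card T"
    unfolding D using card_Diff_subset[OF _ T_sub] card_mono[OF _ T_sub]
      finite_subset[OF T_sub] by simp
  ultimately show ?thesis by simp
qed

section \<open>Upward and downward passages\<close>

definition ascends_exactly_from :: "nat set \<Rightarrow> nat \<Rightarrow> nat \<Rightarrow> bool" where
  "ascends_exactly_from A x y \<longleftrightarrow> (x \<in> A \<longleftrightarrow> x < y)"

text \<open>The words of this kind with \<open>B = A\<close> are the block sequences written out as words (\<open>A\<close> being the odd
  letters). The two parameters differ only by the one letter whose type is being varied: it is left
  according to \<open>A\<close> and entered according to \<open>B\<close>.\<close>

definition ascent_or_drop :: "nat set \<Rightarrow> nat set \<Rightarrow> nat \<Rightarrow> nat \<Rightarrow> bool" where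
  "ascent_or_drop A B x y \<longleftrightarrow> x < y \<or> (x \<notin> A \<and> y \<in> B)"

text \<open>Fusing an odd letter with the even letter after it creates a letter \<open>k\<close> with the freedom of both
  types: as an even letter it may be followed by any odd letter, as an odd letter it may be preceded
  by any even one. The tours in which \<open>k\<close> behaves like an even letter and those in which it
  behaves like an odd letter do not fill this set and are not disjoint. They meet in the tours where
  \<open>k\<close> sits at an upward passage (smaller predecessor, larger successor); they miss the tours where
  \<open>k\<close> sits at a downward passage. The two errors cancel: moving \<open>k\<close> to the left across the maximal
  run of smaller letters in front of it takes it from an upward passage to the downward passage
  where this run was entered, which exists because the cycle starts at \<open>N > k\<close>.
  The reverse move goes to the right over the run of smaller letters behind \<open>k\<close>, and it stops
  because the cycle also ends at \<open>N\<close>.\<close>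

lemma card_tours_flexible_letter:
  fixes A :: "nat set"
  assumes k: "k \<notin> T" "k \<notin> A" "k < N"
  shows "card (tours N (insert k T) (ascent_or_drop A (insert k A))) =
    card (tours N (insert k T) (ascent_or_drop A A)) +
    card (tours N (insert k T) (ascent_or_drop (insert k A) (insert k A)))"
proof -
  let ?K = "insert k A"
  define W where "W B C = tours N (insert k T) (ascent_or_drop B C)" for B C
  define pre where "pre us = successively (ascent_or_drop A A) (N # us)" for us
  define post where "post vs = successively (ascent_or_drop A A) (vs @ [N])" for vs
  have W_iff: "us @ k # vs \<in> W B C \<longleftrightarrow> us @ k # vs \<in> permutations_of_set (insert k T) \<and>
      pre us \<and> post vs \<and> ascent_or_drop B C (last (N # us)) k \<and>
      ascent_or_drop B C k (hd (vs @ [N]))"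
    if "B \<in> {A, ?K}" "C \<in> {A, ?K}" for us vs B C
  proof (cases "us @ k # vs \<in> permutations_of_set (insert k T)")
    case True
    then have nk: "k \<notin> set (N # us)" "k \<notin> set (vs @ [N])"
      using k by (auto simp: permutations_of_set_def)
    have eq: "successively (ascent_or_drop B C) xs \<longleftrightarrow> successively (ascent_or_drop A A) xs"
      if "k \<notin> set xs" for xs
      by (rule successively_cong) (use that \<open>B \<in> _\<close> \<open>C \<in> _\<close> in \<open>auto simp: ascent_or_drop_def\<close>)
    have "successively (ascent_or_drop B C) ((N # us) @ [k] @ (vs @ [N])) \<longleftrightarrow>
      pre us \<and> post vs \<and> ascent_or_drop B C (last (N # us)) k \<and>
      ascent_or_drop B C k (hd (vs @ [N]))"
      unfolding pre_def post_def eq[OF nk(1), symmetric] eq[OF nk(2), symmetric]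
      by (subst successively_append_iff, subst successively_append_iff) auto
    with True show ?thesis by (simp add: W_def tours_def)
  qed (auto simp: W_def tours_def)
  have sub: "W A A \<union> W ?K ?K \<subseteq> W A ?K"
    unfolding W_def tours_def
    by (auto intro: successively_mono simp: ascent_or_drop_def)
  have int: "W A A \<inter> W ?K ?K = W ?K A"
  proof -
    have "ascent_or_drop ?K A = (\<lambda>x y. ascent_or_drop A A x y \<and> ascent_or_drop ?K ?K x y)"
      by (auto simp: ascent_or_drop_def fun_eq_iff)
    then show ?thesis unfolding W_def tours_def by (auto simp: successively_conj)
  qed
  \<comment> \<open>\<open>W ?K A\<close> holds the tours counted twice, \<open>D\<close> those not counted at all\<close>
  define D where "D = W A ?K - (W A A \<union> W ?K ?K)"

  \<comment> \<open>\<open>ls\<close> is the run of letters below \<open>k\<close> that \<open>k\<close> jumps over\<close>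
  define good where "good = (\<lambda>(us, ls, vs).
    us @ ls @ k # vs \<in> permutations_of_set (insert k T) \<and> ls \<noteq> [] \<and> (\<forall>x\<in>set ls. x < k) \<and>
    k < last (N # us) \<and> k < hd (vs @ [N]) \<and> pre us \<and> successively (ascent_or_drop A A) ls \<and>
    post vs \<and> last (N # us) \<notin> A \<and> hd ls \<in> A)"
  have perm_move: "us @ ls @ k # vs \<in> permutations_of_set (insert k T) \<longleftrightarrow>
      us @ k # ls @ vs \<in> permutations_of_set (insert k T)" for us ls vs
    by (auto simp: permutations_of_set_def)
  have last_k: "last (N # us) \<noteq> k"
    if "us @ k # vs \<in> permutations_of_set (insert k T)" for us vs
    using that k by (auto simp: permutations_of_set_def split: if_splits)
  have hd_k: "hd (vs @ [N]) \<noteq> k"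
    if "us @ k # vs \<in> permutations_of_set (insert k T)" for us vs
    using that k by (cases vs) (auto simp: permutations_of_set_def)
  have I_iff: "us @ k # vs \<in> W ?K A \<longleftrightarrow> us @ k # vs \<in> permutations_of_set (insert k T) \<and>
      pre us \<and> post vs \<and> last (N # us) < k \<and> k < hd (vs @ [N])" for us vs
    using k by (subst W_iff) (auto simp: ascent_or_drop_def)
  have D_iff: "us @ k # vs \<in> D \<longleftrightarrow> us @ k # vs \<in> permutations_of_set (insert k T) \<and>
      pre us \<and> post vs \<and> k < last (N # us) \<and> hd (vs @ [N]) < k \<and>
      last (N # us) \<notin> A \<and> hd (vs @ [N]) \<in> A" for us vs
    unfolding D_def
    using k last_k[of us vs] hd_k[of us vs]
    by (auto simp: W_iff ascent_or_drop_def)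

  have "bij_betw (\<lambda>(us, ls, vs). us @ ls @ k # vs) (Collect good) (W ?K A)"
    unfolding bij_betw_def
  proof
    show "inj_on (\<lambda>(us, ls, vs). us @ ls @ k # vs) (Collect good)"
    proof (rule inj_onI)
      fix t t' assume tt: "t \<in> Collect good" "t' \<in> Collect good"
        "(\<lambda>(us, ls, vs). us @ ls @ k # vs) t = (\<lambda>(us, ls, vs). us @ ls @ k # vs) t'"
      obtain us ls vs us' ls' vs' where t: "t = (us, ls, vs)" "t' = (us', ls', vs')"
        by (metis prod.exhaust)
      have g: "good (us, ls, vs)" "good (us', ls', vs')"
        and eq: "us @ ls @ k # vs = us' @ ls' @ k # vs'"
        using tt unfolding t by auto
      have "k \<notin> set (us @ ls)" "k \<notin> set vs"
        using g by (auto simp: good_def permutations_of_set_def)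
      then have "us @ ls = us' @ ls' \<and> vs = vs'"
        using eq append_Cons_eq_iff[of k "us @ ls" vs "us' @ ls'" vs'] by simp
      moreover have "takeWhile (\<lambda>x. x < k) (rev (us @ ls)) = rev ls"
        if "good (us, ls, vs)" for us ls vs
        using that by (cases us rule: rev_cases) (auto simp: good_def takeWhile_append)
      ultimately show "t = t'"
        unfolding t using g by (metis append_same_eq rev_is_rev_conv rev_rev_ident)
    qed
    show "(\<lambda>(us, ls, vs). us @ ls @ k # vs) ` Collect good = W ?K A"
    proof (intro equalityI subsetI)
      fix w assume "w \<in> (\<lambda>(us, ls, vs). us @ ls @ k # vs) ` Collect good"
      then obtain us ls vs where w: "w = (us @ ls) @ k # vs" and g: "good (us, ls, vs)" by auto
      have "successively (ascent_or_drop A A) ((N # us) @ ls)"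
        unfolding successively_append_iff[of _ "N # us"] using g
        by (simp add: good_def pre_def ascent_or_drop_def del: last.simps)
      then have "pre (us @ ls)" by (simp add: pre_def)
      moreover have "last (N # us @ ls) < k" using g by (auto simp: good_def)
      ultimately show "w \<in> W ?K A"
        unfolding w I_iff using g by (simp add: good_def del: last.simps)
    next
      fix w assume w: "w \<in> W ?K A"
      then have "w \<in> permutations_of_set (insert k T)" by (simp add: W_def tours_def)
      then obtain zs vs where s: "w = zs @ k # vs" by (rule split_at_letter) auto
      define us where "us = rev (dropWhile (\<lambda>x. x < k) (rev zs))"
      define ls where "ls = rev (takeWhile (\<lambda>x. x < k) (rev zs))"
      have zs: "zs = us @ ls"
        unfolding us_def ls_def by (metis rev_append rev_rev_ident takeWhile_dropWhile_id)
      have I: "us @ ls @ k # vs \<in> permutations_of_set (insert k T)" "pre (us @ ls)" "post vs"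
          "last (N # us @ ls) < k" "k < hd (vs @ [N])"
        using w unfolding s I_iff zs by auto
      have ls: "\<forall>x\<in>set ls. x < k" unfolding ls_def by (auto dest: set_takeWhileD)
      have "\<not> last us < k" if "us \<noteq> []"
        using that hd_dropWhile[of "\<lambda>x. x < k" "rev zs"] unfolding us_def by (simp add: last_rev)
      then have us: "\<not> last (N # us) < k" using k by auto
      have ne: "ls \<noteq> []" using us I(4) by (cases "us = []") auto
      have "last (N # us) \<noteq> k" using I(1) k by (auto simp: permutations_of_set_def split: if_splits)
      then have usk: "k < last (N # us)" using us by linarith
      have "successively (ascent_or_drop A A) ((N # us) @ ls)" using I(2) by (simp add: pre_def)
      then have p: "pre us" "successively (ascent_or_drop A A) ls"
          "ascent_or_drop A A (last (N # us)) (hd ls)"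
        using ne unfolding successively_append_iff pre_def by auto
      have "hd ls < k" using ls ne by simp
      then have "last (N # us) \<notin> A \<and> hd ls \<in> A"
        using p(3) usk by (simp add: ascent_or_drop_def)
      then have "good (us, ls, vs)" using I p ls ne usk by (simp add: good_def)
      then show "w \<in> (\<lambda>(us, ls, vs). us @ ls @ k # vs) ` Collect good"
        using s zs by (intro image_eqI[of _ _ "(us, ls, vs)"]) auto
    qed
  qed
  moreover have "bij_betw (\<lambda>(us, ls, vs). us @ k # ls @ vs) (Collect good) D"
    unfolding bij_betw_def
  proof
    show "inj_on (\<lambda>(us, ls, vs). us @ k # ls @ vs) (Collect good)"
    proof (rule inj_onI)
      fix t t' assume tt: "t \<in> Collect good" "t' \<in> Collect good"
        "(\<lambda>(us, ls, vs). us @ k # ls @ vs) t = (\<lambda>(us, ls, vs). us @ k # ls @ vs) t'"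
      obtain us ls vs us' ls' vs' where t: "t = (us, ls, vs)" "t' = (us', ls', vs')"
        by (metis prod.exhaust)
      have g: "good (us, ls, vs)" "good (us', ls', vs')"
        and eq: "us @ k # ls @ vs = us' @ k # ls' @ vs'"
        using tt unfolding t by auto
      have "k \<notin> set us" "k \<notin> set (ls @ vs)"
        using g by (auto simp: good_def permutations_of_set_def)
      then have "us = us' \<and> ls @ vs = ls' @ vs'"
        using eq append_Cons_eq_iff[of k us "ls @ vs" us' "ls' @ vs'"] by simp
      moreover have "takeWhile (\<lambda>x. x < k) (ls @ vs) = ls"
        if "good (us, ls, vs)" for us ls vs
        using that by (cases vs) (auto simp: good_def takeWhile_append)
      ultimately show "t = t'"
        unfolding t using g by (metis same_append_eq)
    qed
    show "(\<lambda>(us, ls, vs). us @ k # ls @ vs) ` Collect good = D"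
    proof (intro equalityI subsetI)
      fix w assume "w \<in> (\<lambda>(us, ls, vs). us @ k # ls @ vs) ` Collect good"
      then obtain us ls vs where w: "w = us @ k # (ls @ vs)" and g: "good (us, ls, vs)" by auto
      have "last ls < k" "k < hd (vs @ [N])" using g by (auto simp: good_def)
      then have "last ls < hd (vs @ [N])" by (rule less_trans)
      then have "post (ls @ vs)"
        using g unfolding good_def post_def append_assoc successively_append_iff[of _ ls]
        by (auto simp: ascent_or_drop_def)
      moreover have "hd ((ls @ vs) @ [N]) = hd ls" "hd ls < k" using g by (auto simp: good_def)
      ultimately show "w \<in> D"
        unfolding w D_iff using g perm_move by (simp add: good_def del: last.simps)
    next
      fix w assume w: "w \<in> D"
      then have "w \<in> permutations_of_set (insert k T)" by (simp add: D_def W_def tours_def)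
      then obtain us zs where s: "w = us @ k # zs" by (rule split_at_letter) auto
      define ls where "ls = takeWhile (\<lambda>x. x < k) zs"
      define vs where "vs = dropWhile (\<lambda>x. x < k) zs"
      have zs: "zs = ls @ vs" unfolding ls_def vs_def by simp
      have I: "us @ ls @ k # vs \<in> permutations_of_set (insert k T)" "pre us" "post (ls @ vs)"
          "k < last (N # us)" "hd (ls @ vs @ [N]) < k" "last (N # us) \<notin> A" "hd (ls @ vs @ [N]) \<in> A"
        using w unfolding s D_iff zs perm_move by auto
      have ls: "\<forall>x\<in>set ls. x < k" unfolding ls_def by (auto dest: set_takeWhileD)
      have "\<not> hd vs < k" if "vs \<noteq> []"
        using that hd_dropWhile[of "\<lambda>x. x < k" zs] unfolding vs_def by simp
      then have vs: "\<not> hd (vs @ [N]) < k" using k by (cases vs) auto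
      have ne: "ls \<noteq> []" using vs I(5) by auto
      have "hd (vs @ [N]) \<noteq> k"
        using I(1) k by (cases vs) (auto simp: permutations_of_set_def)
      then have vsk: "k < hd (vs @ [N])" using vs by linarith
      have "successively (ascent_or_drop A A) (ls @ (vs @ [N]))" using I(3) by (simp add: post_def)
      then have p: "post vs" "successively (ascent_or_drop A A) ls"
        unfolding successively_append_iff[of _ ls] post_def by auto
      then have "good (us, ls, vs)" using I p ls ne vsk by (simp add: good_def)
      then show "w \<in> (\<lambda>(us, ls, vs). us @ k # ls @ vs) ` Collect good"
        using s zs by (intro image_eqI[of _ _ "(us, ls, vs)"]) auto
    qed
  qed
  ultimately have "card (W ?K A) = card D"
    using bij_betw_same_card by metis
  moreover have fin: "finite (W B C)" for B C by (simp add: W_def)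
  moreover have "card D = card (W A ?K) - card (W A A \<union> W ?K ?K)"
    unfolding D_def using fin by (intro card_Diff_subset[OF _ sub]) auto
  moreover have "card (W A A \<union> W ?K ?K) \<le> card (W A ?K)"
    by (rule card_mono[OF fin sub])
  moreover have "card (W A A) + card (W ?K ?K) = card (W A A \<union> W ?K ?K) + card (W ?K A)"
    using card_Un_Int[OF fin fin] int by metis
  ultimately show ?thesis by (simp add: W_def)
qed

section \<open>The common recurrence\<close>

text \<open>This is what permits trading the types of two letters that are neighbours in the ground set:
  renaming one into the other leaves all steps between other pairs intact.\<close>

lemma transpose_preserves_less:
  fixes k l x y :: nat
  assumes "k < l" "\<not> (k < x \<and> x < l)" "\<not> (k < y \<and> y < l)" "(x, y) \<noteq> (k, l)" "(x, y) \<noteq> (l, k)"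
  shows "transpose k l x < transpose k l y \<longleftrightarrow> x < y"
  using assms by (auto simp: transpose_def)

text \<open>Think of the letters in \<open>A\<close> as odd and of the others as even. Let \<open>k\<close> (odd) and \<open>l\<close> (even) be
  neighbouring values, and trade their types. Apart from
  the order of \<open>k\<close> and \<open>l\<close> the rules for all letters stay the same, so a tour in which they are not
  adjacent survives; with traded types \<open>k\<close> and \<open>l\<close> can never be adjacent. The tours lost by the
  trade are those containing \<open>k l\<close>, where the fused letter must be followed by a smaller one and so
  is of even type, and those containing \<open>l k\<close>, where it is of odd type.\<close>

lemma card_tours_ascends_exactly_from_swap:
  assumes kl: "k \<in> A" "l \<notin> A" "k \<in> S" "l \<in> S" "k < l"
    and gap: "\<forall>x\<in>S. \<not> (k < x \<and> x < l)"
    and N: "\<forall>x\<in>S. x < N"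
  shows "card (tours N S (ascends_exactly_from A)) =
    card (tours N S (ascends_exactly_from (insert l (A - {k})))) +
    card (tours N (S - {l}) (ascends_exactly_from A)) +
    card (tours N (S - {l}) (ascends_exactly_from (A - {k})))"
proof -
  let ?A' = "insert l (A - {k})"
  let ?P = "ascends_exactly_from A"
  let ?P1 = "\<lambda>x y. ?P x y \<and> (x, y) \<noteq> (k, l)"
  let ?P2 = "\<lambda>x y. ?P1 x y \<and> (x, y) \<noteq> (l, k)"
  have NS: "N \<notin> S" and lN: "l < N" "k < N" using N kl by auto
  have gapN: "\<not> (k < x \<and> x < l)" if "x \<in> insert N S" for x
    using gap that lN by auto
  have Sl: "insert k (S - {k, l}) = S - {l}" "insert k (S - {l, k}) = S - {l}"
    "S - {l} \<noteq> {}" "N \<notin> S - {l}" using kl NS by auto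
  have "card (tours N S ?P) = card (tours N S ?P1) +
      card (tours N (S - {l}) (\<lambda>x y. ?P (if x = k then l else x) (if y = k then k else y)))"
    using card_tours_delete_contract[of k S l ?P N k] kl NS lN
    by (simp add: ascends_exactly_from_def Sl)
  moreover have "tours N (S - {l}) (\<lambda>x y. ?P (if x = k then l else x) (if y = k then k else y)) =
      tours N (S - {l}) (ascends_exactly_from (A - {k}))"
  proof (rule tours_cong[OF Sl(3,4)])
    fix x y assume xy: "x \<in> insert N (S - {l})" "y \<in> insert N (S - {l})" "x \<noteq> y"
    then have "\<not> (k < x \<and> x < l)" "\<not> (k < y \<and> y < l)" "x \<noteq> l" "y \<noteq> l"
      using gapN lN by auto
    then show "?P (if x = k then l else x) (if y = k then k else y) \<longleftrightarrow>
        ascends_exactly_from (A - {k}) x y"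
      using kl xy by (auto simp: ascends_exactly_from_def)
  qed
  \<comment> \<open>here the contracted edge leads from \<open>l\<close> down to \<open>k\<close>\<close>
  moreover have "card (tours N S ?P1) = card (tours N S ?P2) +
      card (tours N (S - {l}) (\<lambda>x y. ?P1 (if x = k then k else x) (if y = k then l else y)))"
    using card_tours_delete_contract[of l S k ?P1 N k] kl NS lN
    by (simp add: ascends_exactly_from_def Sl)
  moreover have "tours N (S - {l}) (\<lambda>x y. ?P1 (if x = k then k else x) (if y = k then l else y)) =
      tours N (S - {l}) (ascends_exactly_from A)"
  proof (rule tours_cong[OF Sl(3,4)])
    fix x y assume xy: "x \<in> insert N (S - {l})" "y \<in> insert N (S - {l})" "x \<noteq> y"
    then have "\<not> (k < x \<and> x < l)" "\<not> (k < y \<and> y < l)" "x \<noteq> l" "y \<noteq> l"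
      using gapN lN by auto
    then show "?P1 (if x = k then k else x) (if y = k then l else y) \<longleftrightarrow> ?P x y"
      using kl xy by (auto simp: ascends_exactly_from_def)
  qed
  \<comment> \<open>the tours avoiding both edges are those for the traded types\<close>
  moreover have "card (tours N S ?P2) = card (tours N S (ascends_exactly_from ?A'))"
  proof -
    have "card (tours N S ?P2) = card (tours N (transpose k l ` S) (ascends_exactly_from ?A'))"
    proof (rule card_tours_relabel)
      show "inj_on (transpose k l) (insert N S)" by (rule inj_on_subset[OF inj_transpose]) simp
      show "transpose k l N = N" using lN by (simp add: transpose_def)
      fix x y assume xy: "x \<in> insert N S" "y \<in> insert N S"
      have mem: "transpose k l x \<in> ?A' \<longleftrightarrow> x \<in> A"
        using kl by (auto simp: transpose_def)
      show "?P2 x y \<longleftrightarrow> ascends_exactly_from ?A' (transpose k l x) (transpose k l y)"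
      proof (cases "(x, y) = (k, l) \<or> (x, y) = (l, k)")
        case True
        then show ?thesis using kl by (auto simp: ascends_exactly_from_def)
      next
        case False
        then show ?thesis
          using transpose_preserves_less[OF kl(5) gapN[OF xy(1)] gapN[OF xy(2)]] mem
          by (auto simp: ascends_exactly_from_def)
      qed
    qed
    also have "transpose k l ` S = S" using kl by (simp add: transpose_image_eq)
    finally show ?thesis .
  qed
  ultimately show ?thesis by simp
qed

text \<open>The same trade of types for the other kind of word. Here only the factor \<open>k l\<close> is lost, as \<open>l k\<close> is
  allowed before the trade as a drop and becomes an ascent after it. The fused letter is now of both
  types, and the count of its tours splits into the counts for the two types by
  the cancellation of upward and downward passages.\<close>

lemma card_tours_ascent_or_drop_swap:
  assumes kl: "k \<in> A" "l \<notin> A" "k \<in> S" "l \<in> S" "k < l"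
    and gap: "\<forall>x\<in>S. \<not> (k < x \<and> x < l)"
    and N: "\<forall>x\<in>S. x < N"
  shows "card (tours N S (ascent_or_drop A A)) =
    card (tours N S (ascent_or_drop (insert l (A - {k})) (insert l (A - {k})))) +
    card (tours N (S - {l}) (ascent_or_drop A A)) +
    card (tours N (S - {l}) (ascent_or_drop (A - {k}) (A - {k})))"
proof -
  let ?A' = "insert l (A - {k})"
  let ?P = "ascent_or_drop A A"
  let ?P1 = "\<lambda>x y. ?P x y \<and> (x, y) \<noteq> (k, l)"
  have NS: "N \<notin> S" and lN: "l < N" "k < N" using N kl by auto
  have gapN: "\<not> (k < x \<and> x < l)" if "x \<in> insert N S" for x
    using gap that lN by auto
  have Sl: "insert k (S - {k, l}) = S - {l}" "S - {l} \<noteq> {}" "N \<notin> S - {l}" using kl NS by auto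
  have "card (tours N S ?P) = card (tours N S ?P1) +
      card (tours N (S - {l}) (\<lambda>x y. ?P (if x = k then l else x) (if y = k then k else y)))"
    using card_tours_delete_contract[of k S l ?P N k] kl NS lN
    by (simp add: ascent_or_drop_def Sl)
  moreover have "tours N (S - {l}) (\<lambda>x y. ?P (if x = k then l else x) (if y = k then k else y)) =
      tours N (S - {l}) (ascent_or_drop (A - {k}) A)"
  proof (rule tours_cong[OF Sl(2,3)])
    fix x y assume xy: "x \<in> insert N (S - {l})" "y \<in> insert N (S - {l})" "x \<noteq> y"
    then have "\<not> (k < x \<and> x < l)" "\<not> (k < y \<and> y < l)" "x \<noteq> l" "y \<noteq> l"
      using gapN lN by auto
    then show "?P (if x = k then l else x) (if y = k then k else y) \<longleftrightarrow>
        ascent_or_drop (A - {k}) A x y"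
      using kl xy by (auto simp: ascent_or_drop_def)
  qed
  moreover have "card (tours N (S - {l}) (ascent_or_drop (A - {k}) A)) =
      card (tours N (S - {l}) (ascent_or_drop (A - {k}) (A - {k}))) +
      card (tours N (S - {l}) (ascent_or_drop A A))"
    using card_tours_flexible_letter[of k "S - {k, l}" "A - {k}" N] kl lN
    by (simp add: Sl insert_absorb)
  moreover have "card (tours N S ?P1) = card (tours N S (ascent_or_drop ?A' ?A'))"
  proof -
    have "card (tours N S ?P1) = card (tours N (transpose k l ` S) (ascent_or_drop ?A' ?A'))"
    proof (rule card_tours_relabel)
      show "inj_on (transpose k l) (insert N S)" by (rule inj_on_subset[OF inj_transpose]) simp
      show "transpose k l N = N" using lN by (simp add: transpose_def)
      fix x y assume xy: "x \<in> insert N S" "y \<in> insert N S"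
      have mem: "transpose k l z \<in> ?A' \<longleftrightarrow> z \<in> A" for z
        using kl by (auto simp: transpose_def)
      show "?P1 x y \<longleftrightarrow> ascent_or_drop ?A' ?A' (transpose k l x) (transpose k l y)"
      proof (cases "(x, y) = (k, l) \<or> (x, y) = (l, k)")
        case True
        then show ?thesis using kl by (auto simp: ascent_or_drop_def)
      next
        case False
        then show ?thesis
          using transpose_preserves_less[OF kl(5) gapN[OF xy(1)] gapN[OF xy(2)]] mem
          by (auto simp: ascent_or_drop_def)
      qed
    qed
    also have "transpose k l ` S = S" using kl by (simp add: transpose_image_eq)
    finally show ?thesis .
  qed
  ultimately show ?thesis by simp
qed

lemma tours_min_letter:
  assumes "finite S" "S \<noteq> {}" "\<forall>x\<in>S. x < N" "w \<in> tours N S P"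
  obtains x y where "x \<in> insert N S" "Min S < x" "P x (Min S)"
    "y \<in> insert N S" "Min S < y" "P (Min S) y"
proof -
  have m: "Min S \<in> S" using assms by simp
  have "w \<in> permutations_of_set S" using assms(4) by (simp add: tours_def)
  then obtain us vs where w: "w = us @ Min S # vs" and set: "set us \<union> set vs = S - {Min S}"
    using m by (rule split_at_letter) auto
  have "successively P ((N # us) @ Min S # (vs @ [N]))"
    using assms(4) w by (simp add: tours_def)
  then have P: "P (last (N # us)) (Min S)" "P (Min S) (hd (vs @ [N]))"
    unfolding successively_append_iff[of _ "N # us"] by (auto simp: successively_Cons)
  have "last (N # us) \<in> insert N (set us)" "hd (vs @ [N]) \<in> insert N (set vs)"
    by (auto simp: hd_append)
  then have "last (N # us) \<in> insert N (S - {Min S})" "hd (vs @ [N]) \<in> insert N (S - {Min S})"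
    using set by blast+
  moreover have "Min S < x" if "x \<in> insert N (S - {Min S})" for x
  proof (cases "x \<in> S")
    case True
    then have "Min S \<le> x" "x \<noteq> Min S" using that assms(1,3) m by auto
    then show ?thesis by simp
  qed (use that assms(3) m in auto)
  ultimately show thesis
    using that[of "last (N # us)" "hd (vs @ [N])"] P by auto
qed

text \<open>In every summand of the recurrence the letter \<open>l\<close> outside \<open>A\<close> is replaced by the smaller \<open>k\<close> or
  disappears, so the sum of the letters outside \<open>A\<close> decreases. The recurrence applies whenever some letter outside \<open>A\<close> has a neighbour below it in \<open>A\<close>.
  Otherwise the smallest letter is outside \<open>A\<close>, where it can have no successor in one kind of tour
  and no predecessor in the other, or all letters are in \<open>A\<close>, where the two conditions coincide.\<close>

lemma card_tours_ascends_exactly_from_eq: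
  assumes "finite S" "S \<noteq> {}" "N \<notin> A" "\<forall>x\<in>S. x < N"
  shows "card (tours N S (ascends_exactly_from A)) = card (tours N S (ascent_or_drop A A))"
  using assms
proof (induction "\<Sum>(S - A)" arbitrary: S A rule: less_induct)
  case less
  note fin = less.prems(1) and ne = less.prems(2) and N = less.prems(3,4)
  consider "Min S \<notin> A" | "S \<subseteq> A" | "Min S \<in> A" "\<not> S \<subseteq> A" by blast
  then show ?case
  proof cases
    case 1
    have "w \<notin> tours N S (ascends_exactly_from A)" for w
    proof
      assume "w \<in> tours N S (ascends_exactly_from A)"
      then show False
        by (rule tours_min_letter[OF fin ne N(2)]) (use 1 in \<open>auto simp: ascends_exactly_from_def\<close>)
    qed
    moreover have "w \<notin> tours N S (ascent_or_drop A A)" for w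
    proof
      assume "w \<in> tours N S (ascent_or_drop A A)"
      then show False
        by (rule tours_min_letter[OF fin ne N(2)]) (use 1 in \<open>auto simp: ascent_or_drop_def\<close>)
    qed
    ultimately have "tours N S (ascends_exactly_from A) = {}" "tours N S (ascent_or_drop A A) = {}"
      by auto
    then show ?thesis by simp
  next
    case 2
    have "tours N S (ascends_exactly_from A) = tours N S (ascent_or_drop A A)"
      by (rule tours_cong)
        (use 2 ne N in \<open>auto simp: ascends_exactly_from_def ascent_or_drop_def\<close>)
    then show ?thesis by simp
  next
    case 3
    \<comment> \<open>the least letter outside \<open>A\<close>: then its lower neighbour is in \<open>A\<close>\<close>
    define l where "l = Min (S - A)"
    have finE: "finite (S - A)" and neE: "S - A \<noteq> {}" using fin 3 by auto
    have l: "l \<in> S" "l \<notin> A" using Min_in[OF finE neE] by (auto simp: l_def)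
    define k where "k = Max {x \<in> S. x < l}"
    have "Min S \<in> S" "Min S \<noteq> l" "Min S \<le> l" using fin ne l 3 by auto
    then have "{x \<in> S. x < l} \<noteq> {}" by auto
    then have "k \<in> {x \<in> S. x < l}" unfolding k_def using fin by (intro Max_in) auto
    then have k: "k \<in> S" "k < l" by auto
    have gap: "\<forall>x\<in>S. \<not> (k < x \<and> x < l)"
      using fin Max_ge[of "{x \<in> S. x < l}"] by (auto simp: k_def not_less)
    have kA: "k \<in> A"
    proof (rule ccontr)
      assume "k \<notin> A"
      then have "l \<le> k" using k finE by (simp add: l_def)
      with k show False by simp
    qed
    let ?A' = "insert l (A - {k})"
    have sum: "\<Sum>(S - A) = l + \<Sum>(S - A - {l})"
      using l finE by (simp add: sum.remove)
    have "S - {l} - (A - {k}) = insert k (S - A - {l})" "S - ?A' = insert k (S - A - {l})"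
      "S - {l} - A = S - A - {l}"
      using k l kA by auto
    then have smaller: "\<Sum>(S - ?A') < \<Sum>(S - A)" "\<Sum>(S - {l} - A) < \<Sum>(S - A)"
      "\<Sum>(S - {l} - (A - {k})) < \<Sum>(S - A)"
      using sum k kA finE by auto
    have ne': "S - {l} \<noteq> {}" using k by auto
    have lN: "N \<noteq> l" using N(2) l by auto
    have "card (tours N S (ascends_exactly_from ?A')) = card (tours N S (ascent_or_drop ?A' ?A'))"
      by (rule less.hyps[OF smaller(1)]) (use fin ne N lN in auto)
    moreover have "card (tours N (S - {l}) (ascends_exactly_from A)) =
        card (tours N (S - {l}) (ascent_or_drop A A))"
      by (rule less.hyps[OF smaller(2)]) (use fin ne' N in auto)
    moreover have "card (tours N (S - {l}) (ascends_exactly_from (A - {k}))) =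
        card (tours N (S - {l}) (ascent_or_drop (A - {k}) (A - {k})))"
      by (rule less.hyps[OF smaller(3)]) (use fin ne' N in auto)
    ultimately show ?thesis
      unfolding card_tours_ascends_exactly_from_swap[OF kA l(2) k(1) l(1) k(2) gap N(2)]
        card_tours_ascent_or_drop_swap[OF kA l(2) k(1) l(1) k(2) gap N(2)]
      by simp
  qed
qed

section \<open>Block sequences as words\<close>

lemma append_prefix_unique:
  assumes "xs @ ys = xs' @ ys'" "\<forall>x\<in>set xs. p x" "\<forall>x\<in>set xs'. p x"
    "ys = [] \<or> \<not> p (hd ys)" "ys' = [] \<or> \<not> p (hd ys')"
  shows "xs = xs' \<and> ys = ys'"
proof -
  have "takeWhile p (xs @ ys) = xs" if "\<forall>x\<in>set xs. p x" "ys = [] \<or> \<not> p (hd ys)" for xs ys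
    using that by (cases ys) (auto simp: takeWhile_append)
  then have "xs = xs'" using assms by metis
  then show ?thesis using assms(1) by simp
qed

text \<open>Writing every block in increasing order loses nothing: the blocks are the maximal runs of letters of
  equal parity, since consecutive blocks have opposite parity. The condition
  \<open>max R < min C\<close> says that the step from \<open>R\<close> to \<open>C\<close> is an ascent, while the step
  from \<open>C\<close> to the next odd block is free.\<close>

fun block_word :: "nat set list \<Rightarrow> nat set list \<Rightarrow> nat list" where
  "block_word [] Cs = []"
| "block_word (R # Rs) [] = sorted_list_of_set R"
| "block_word (R # Rs) (C # Cs) = sorted_list_of_set R @ sorted_list_of_set C @ block_word Rs Cs"

text \<open>The conditions on a block sequence that concern single blocks and neighbouring blocks. That the
  blocks partition the right ground set is expressed through the word: it must be a permutation.\<close>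

inductive block_chain :: "nat set list \<Rightarrow> nat set list \<Rightarrow> bool" where
  single: "finite R \<Longrightarrow> R \<noteq> {} \<Longrightarrow> \<forall>x\<in>R. odd x \<Longrightarrow> block_chain [R] []"
| cons: "finite R \<Longrightarrow> R \<noteq> {} \<Longrightarrow> \<forall>x\<in>R. odd x \<Longrightarrow> finite C \<Longrightarrow> C \<noteq> {} \<Longrightarrow> \<forall>x\<in>C. even x \<Longrightarrow>
    Max R < Min C \<Longrightarrow> block_chain Rs Cs \<Longrightarrow> block_chain (R # Rs) (C # Cs)"

lemma block_chain_iff:
  "block_chain Rs Cs \<longleftrightarrow> length Rs = length Cs + 1 \<and>
    (\<forall>R\<in>set Rs. finite R \<and> R \<noteq> {} \<and> (\<forall>x\<in>R. odd x)) \<and>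
    (\<forall>C\<in>set Cs. finite C \<and> C \<noteq> {} \<and> (\<forall>x\<in>C. even x)) \<and>
    (\<forall>i < length Cs. Max (Rs ! i) < Min (Cs ! i))"
proof (induction Cs arbitrary: Rs)
  case Nil
  have "block_chain Rs [] \<longleftrightarrow> (\<exists>R. Rs = [R] \<and> finite R \<and> R \<noteq> {} \<and> (\<forall>x\<in>R. odd x))"
    by (subst block_chain.simps) auto
  also have "\<dots> \<longleftrightarrow> length Rs = 1 \<and> (\<forall>R\<in>set Rs. finite R \<and> R \<noteq> {} \<and> (\<forall>x\<in>R. odd x))"
  proof -
    have "length Rs = 1 \<longleftrightarrow> (\<exists>R. Rs = [R])" by (simp add: length_Suc_conv)
    then show ?thesis by fastforce
  qed
  finally show ?case by simp
next
  case (Cons C Cs)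
  show ?case
  proof (cases Rs)
    case Nil
    then show ?thesis by (subst block_chain.simps) simp
  next
    case R: (Cons R Rs')
    have "block_chain (R # Rs') (C # Cs) \<longleftrightarrow> finite R \<and> R \<noteq> {} \<and> (\<forall>x\<in>R. odd x) \<and>
        finite C \<and> C \<noteq> {} \<and> (\<forall>x\<in>C. even x) \<and> Max R < Min C \<and> block_chain Rs' Cs"
      by (subst block_chain.simps) auto
    moreover have "(\<forall>i < length (C # Cs). Max ((R # Rs') ! i) < Min ((C # Cs) ! i)) \<longleftrightarrow>
        Max R < Min C \<and> (\<forall>i < length Cs. Max (Rs' ! i) < Min (Cs ! i))"
      by (simp only: length_Cons All_less_Suc2 nth_Cons_0 nth_Cons_Suc)
    moreover have "length (R # Rs') = length (C # Cs) + 1 \<longleftrightarrow> length Rs' = length Cs + 1"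
      by simp
    ultimately show ?thesis
      unfolding R Cons.IH by (simp only: list.set ball_simps conj_ac)
  qed
qed

definition alternating_word :: "nat list \<Rightarrow> bool" where
  "alternating_word w \<longleftrightarrow> w \<noteq> [] \<and> odd (hd w) \<and> odd (last w) \<and>
    successively (\<lambda>x y. x < y \<or> even x \<and> odd y) w"

lemma sorted_list_of_set_hd_last:
  fixes B :: "nat set"
  assumes "finite B" "B \<noteq> {}"
  shows "hd (sorted_list_of_set B) = Min B" "last (sorted_list_of_set B) = Max B"
proof -
  show "hd (sorted_list_of_set B) = Min B"
    using assms by (simp add: sorted_list_of_set_nonempty)
  have ne: "sorted_list_of_set B \<noteq> []" using assms by simp
  then have eq: "sorted_list_of_set B = butlast (sorted_list_of_set B) @ [last (sorted_list_of_set B)]"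
    by simp
  have "sorted (butlast (sorted_list_of_set B) @ [last (sorted_list_of_set B)])"
    unfolding eq[symmetric] by simp
  moreover have "set (butlast (sorted_list_of_set B) @ [last (sorted_list_of_set B)]) = B"
    unfolding eq[symmetric] using assms by simp
  moreover have "\<forall>x\<in>set (ys @ [y]). x \<le> y" if "sorted (ys @ [y])" for ys and y :: nat
    using that by (auto simp: sorted_append)
  ultimately have "\<forall>x\<in>B. x \<le> last (sorted_list_of_set B)" by metis
  moreover have "last (sorted_list_of_set B) \<in> B"
    using last_in_set[OF ne] assms by simp
  ultimately show "last (sorted_list_of_set B) = Max B"
    using assms(1) by (intro Max_eqI[symmetric]) auto
qed

lemma successively_sorted_list_of_set:
  assumes "\<And>x y. x < y \<Longrightarrow> P x y"
  shows "successively P (sorted_list_of_set (B :: nat set))"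
proof -
  have "successively (<) (sorted_list_of_set B)"
    by (intro successively_if_sorted_wrt) simp
  then show ?thesis by (rule successively_mono) (use assms in auto)
qed

lemma alternating_word_block_word:
  "block_chain Rs Cs \<Longrightarrow> alternating_word (block_word Rs Cs)"
proof (induction rule: block_chain.induct)
  case (single R)
  then have "Min R \<in> R" "Max R \<in> R" by auto
  with single show ?case
    by (auto simp: alternating_word_def sorted_list_of_set_hd_last
        intro: successively_sorted_list_of_set)
next
  case (cons R C Rs Cs)
  then have "Min R \<in> R" "Max C \<in> C" by auto
  then have "odd (Min R)" "even (Max C)" using cons by auto
  with cons show ?case
    by (auto simp: alternating_word_def sorted_list_of_set_hd_last successively_append_iff
        intro!: successively_sorted_list_of_set)
qed

lemma block_word_inject:
  assumes "block_chain Rs Cs" "block_chain Rs' Cs'" "block_word Rs Cs = block_word Rs' Cs'"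
  shows "Rs = Rs' \<and> Cs = Cs'"
  using assms
proof (induction arbitrary: Rs' Cs' rule: block_chain.induct)
  case (single R)
  from single(4) show ?case
  proof cases
    case (single R')
    then show ?thesis using \<open>finite R\<close> \<open>block_word [R] [] = _\<close>
      by (metis block_word.simps(2) sorted_list_of_set_inject)
  next
    case (cons R' C' Rs'' Cs'')
    then have "C' \<subseteq> R"
      using single.prems single.hyps
      by (metis (no_types, lifting) Un_iff block_word.simps(2,3) set_append
          set_sorted_list_of_set subsetI)
    then show ?thesis using cons single.hyps by blast
  qed
next
  case (cons R C Rs Cs)
  note hyps = cons.hyps and IH = cons.IH and eq = cons.prems(2)
  from cons.prems(1) show ?case
  proof cases
    case (single R')
    then have "C \<subseteq> R'"
      using eq hyps
      by (metis (no_types, lifting) Un_iff block_word.simps(2,3) set_append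
          set_sorted_list_of_set subsetI)
    then show ?thesis using hyps single by blast
  next
    case 2: (cons R' C' Rs'' Cs'')
    have a: "alternating_word (block_word Rs Cs)" "alternating_word (block_word Rs'' Cs'')"
      using hyps 2 alternating_word_block_word by auto
    have "even (Min C)" "even (Min C')" using hyps 2 by auto
    then have "sorted_list_of_set R = sorted_list_of_set R' \<and>
        sorted_list_of_set C @ block_word Rs Cs = sorted_list_of_set C' @ block_word Rs'' Cs''"
      using eq hyps 2
      by (intro append_prefix_unique[where p = odd])
        (auto simp: sorted_list_of_set_hd_last)
    moreover from this have "sorted_list_of_set C = sorted_list_of_set C' \<and>
        block_word Rs Cs = block_word Rs'' Cs''"
      using hyps 2 a
      by (intro append_prefix_unique[where p = even]) (auto simp: alternating_word_def)
    ultimately show ?thesis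
      using IH[of Rs'' Cs''] hyps 2 by (auto dest: sorted_list_of_set_inject)
  qed
qed

lemma sorted_list_of_set_run:
  fixes xs :: "nat list"
  assumes "successively (\<lambda>x y. x < y \<or> even x \<and> odd y) xs" "\<forall>x\<in>set xs. even x = e"
  shows "sorted_list_of_set (set xs) = xs"
proof -
  have "successively (\<lambda>x y. x < y \<or> even x \<and> odd y) xs \<longleftrightarrow> successively (<) xs"
    by (rule successively_cong) (use assms(2) in auto)
  then have "sorted_wrt (<) xs"
    using assms(1) by (simp add: successively_conv_sorted_wrt transp_on_less)
  then show ?thesis
    by (simp add: strict_sorted_iff sorted_list_of_set.idem_if_sorted_distinct)
qed

text \<open>The blocks are read off by cutting the word into maximal runs of odd and of even letters; it ends
  with an odd run because its last letter is odd.\<close>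

lemma ex_block_word:
  "alternating_word w \<Longrightarrow> \<exists>Rs Cs. block_chain Rs Cs \<and> block_word Rs Cs = w"
proof (induction "length w" arbitrary: w rule: less_induct)
  case less
  define rs where "rs = takeWhile odd w"
  define w' where "w' = dropWhile odd w"
  have w: "w = rs @ w'" by (simp add: rs_def w'_def)
  note a = less.prems[unfolded alternating_word_def]
  have rs: "rs \<noteq> []" "\<forall>x\<in>set rs. odd x"
    using a by (cases w; auto simp: rs_def dest: set_takeWhileD)+
  have s: "successively (\<lambda>x y. x < y \<or> even x \<and> odd y) rs"
    "successively (\<lambda>x y. x < y \<or> even x \<and> odd y) w'"
    "w' = [] \<or> last rs < hd w' \<or> even (last rs)"
    using a rs unfolding w successively_append_iff by auto
  have R: "sorted_list_of_set (set rs) = rs"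
    by (rule sorted_list_of_set_run[OF s(1), of False]) (use rs in auto)
  show ?case
  proof (cases "w' = []")
    case True
    have "block_chain [set rs] []" using rs by (intro block_chain.single) auto
    then show ?thesis using True w R by (metis append_Nil2 block_word.simps(2))
  next
    case False
    define cs where "cs = takeWhile even w'"
    define v where "v = dropWhile even w'"
    have w': "w' = cs @ v" by (simp add: cs_def v_def)
    have "even (hd w')" using False hd_dropWhile[of odd w] by (simp add: w'_def)
    then have cs: "cs \<noteq> []" "\<forall>x\<in>set cs. even x"
      using False by (cases w'; auto simp: cs_def dest: set_takeWhileD)+
    have "v \<noteq> []"
    proof
      assume "v = []"
      then have "last w = last cs" using w w' cs by simp
      then show False using a cs by auto
    qed
    moreover from this have "odd (hd v)" using hd_dropWhile[of even w'] by (simp add: v_def)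
    moreover have "last v = last w" using \<open>v \<noteq> []\<close> w w' by simp
    ultimately have "alternating_word v"
      using a s(2) unfolding w' successively_append_iff alternating_word_def by auto
    moreover have "length v < length w" using rs w w' by simp
    ultimately obtain Rs Cs where RC: "block_chain Rs Cs" "block_word Rs Cs = v"
      using less.hyps by blast
    have C: "sorted_list_of_set (set cs) = cs"
      by (rule sorted_list_of_set_run[of _ True])
        (use s(2) cs in \<open>auto simp: w' successively_append_iff\<close>)
    have "last rs < hd cs" using s(3) rs False cs w' by auto
    then have "Max (set rs) < Min (set cs)"
      using sorted_list_of_set_hd_last[of "set rs"] sorted_list_of_set_hd_last[of "set cs"]
        R C rs cs by simp
    then have "block_chain (set rs # Rs) (set cs # Cs)"
      using rs cs RC by (intro block_chain.cons) auto
    moreover have "block_word (set rs # Rs) (set cs # Cs) = w"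
      using R C RC w w' by simp
    ultimately show ?thesis by blast
  qed
qed

lemma mset_block_word:
  "length Rs = length Cs + 1 \<Longrightarrow> mset (block_word Rs Cs) =
    mset (concat (map sorted_list_of_set Rs) @ concat (map sorted_list_of_set Cs))"
  by (induction Rs Cs rule: block_word.induct) auto

lemma distinct_concat_blocks_iff:
  fixes Bs :: "nat set list"
  assumes "\<forall>B\<in>set Bs. finite B \<and> B \<noteq> {}"
  shows "distinct (concat (map sorted_list_of_set Bs)) \<and>
      set (concat (map sorted_list_of_set Bs)) = A \<longleftrightarrow> distinct Bs \<and> partition_on A (set Bs)"
proof -
  have "distinct (map sorted_list_of_set Bs) \<longleftrightarrow> distinct Bs"
    unfolding distinct_map using assms
    by (auto simp: inj_on_def dest: sorted_list_of_set_inject)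
  moreover have "removeAll [] (map sorted_list_of_set Bs) = map sorted_list_of_set Bs"
  proof (intro removeAll_id notI)
    assume "[] \<in> set (map sorted_list_of_set Bs)"
    then obtain B where "B \<in> set Bs" "sorted_list_of_set B = []" by auto
    with assms show False by auto
  qed
  moreover have "(\<forall>xs ys. xs \<in> set (map sorted_list_of_set Bs) \<and>
        ys \<in> set (map sorted_list_of_set Bs) \<and> xs \<noteq> ys \<longrightarrow> set xs \<inter> set ys = {}) \<longleftrightarrow>
      disjoint (set Bs)" (is "?L \<longleftrightarrow> _")
  proof -
    have id: "set (sorted_list_of_set B) = B" if "B \<in> set Bs" for B using that assms by simp
    have "?L \<longleftrightarrow> (\<forall>B\<in>set Bs. \<forall>B'\<in>set Bs. sorted_list_of_set B \<noteq> sorted_list_of_set B' \<longrightarrow>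
        set (sorted_list_of_set B) \<inter> set (sorted_list_of_set B') = {})"
      by auto
    also have "\<dots> \<longleftrightarrow> (\<forall>B\<in>set Bs. \<forall>B'\<in>set Bs. B \<noteq> B' \<longrightarrow> B \<inter> B' = {})"
      using id by metis
    finally show ?thesis by (simp add: disjoint_def)
  qed
  moreover have "set (concat (map sorted_list_of_set Bs)) = \<Union>(set Bs)"
    using assms by auto
  ultimately show ?thesis
    using assms unfolding distinct_concat_iff partition_on_def by auto
qed

lemma genocchi_block_seqs_iff:
  "(Rs, Cs) \<in> genocchi_block_seqs n \<longleftrightarrow>
    block_chain Rs Cs \<and> block_word Rs Cs \<in> permutations_of_set {1..2 * n + 1}"
proof -
  let ?O = "{k \<in> {1..2 * n + 1}. odd k}" and ?E = "{k \<in> {1..2 * n}. even k}"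
  have part: "\<forall>B\<in>set Bs. finite B \<and> B \<noteq> {} \<and> B \<subseteq> A"
    if "partition_on A (set Bs)" "finite A" for A and Bs :: "nat set list"
    using that unfolding partition_on_def by (auto intro: finite_subset)
  show ?thesis (is "?L \<longleftrightarrow> ?R")
  proof (cases "block_chain Rs Cs")
    case False
    moreover have "block_chain Rs Cs" if ?L
      using that part[of ?O Rs] part[of ?E Cs]
      unfolding genocchi_block_seqs_def block_chain_iff by fastforce
    ultimately show ?thesis by blast
  next
    case True
    note bc = True[unfolded block_chain_iff]
    let ?r = "concat (map sorted_list_of_set Rs)" and ?c = "concat (map sorted_list_of_set Cs)"
    have r: "\<forall>x\<in>set ?r. odd x" and c: "\<forall>x\<in>set ?c. even x" using bc by auto
    have ms: "mset (block_word Rs Cs) = mset (?r @ ?c)" using bc mset_block_word by blast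
    have "?R \<longleftrightarrow> set (?r @ ?c) = {1..2 * n + 1} \<and> distinct (?r @ ?c)"
      using True mset_eq_setD[OF ms] mset_eq_imp_distinct_iff[OF ms]
      by (simp add: permutations_of_set_def)
    also have "\<dots> \<longleftrightarrow> (distinct ?r \<and> set ?r = ?O) \<and> (distinct ?c \<and> set ?c = ?E)"
    proof -
      have E: "?E = {k \<in> {1..2 * n + 1}. even k}" by (auto simp: le_Suc_eq)
      have "set ?r \<inter> set ?c = {}" using r c by blast
      moreover have "set ?r \<union> set ?c = {1..2 * n + 1} \<longleftrightarrow> set ?r = ?O \<and> set ?c = ?E"
        unfolding E using r c by blast
      ultimately show ?thesis by (simp only: set_append distinct_append) blast
    qed
    also have "\<dots> \<longleftrightarrow> ?L"
    proof -
      have "\<forall>B\<in>set Rs. finite B \<and> B \<noteq> {}" "\<forall>B\<in>set Cs. finite B \<and> B \<noteq> {}"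
        using bc by blast+
      note this[THEN distinct_concat_blocks_iff]
      then show ?thesis
        using bc unfolding genocchi_block_seqs_def mem_Collect_eq prod.case by (simp only:) blast
    qed
    finally show ?thesis by blast
  qed
qed

lemma card_genocchi_block_seqs:
  "card (genocchi_block_seqs n) =
    card {w \<in> permutations_of_set {1..2 * n + 1}. alternating_word w}"
proof (rule bij_betw_same_card[of "\<lambda>(Rs, Cs). block_word Rs Cs"])
  show "bij_betw (\<lambda>(Rs, Cs). block_word Rs Cs) (genocchi_block_seqs n)
      {w \<in> permutations_of_set {1..2 * n + 1}. alternating_word w}"
    unfolding bij_betw_def
  proof
    show "inj_on (\<lambda>(Rs, Cs). block_word Rs Cs) (genocchi_block_seqs n)"
      using block_word_inject by (auto intro!: inj_onI simp: genocchi_block_seqs_iff)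
    show "(\<lambda>(Rs, Cs). block_word Rs Cs) ` genocchi_block_seqs n =
        {w \<in> permutations_of_set {1..2 * n + 1}. alternating_word w}"
    proof (intro equalityI subsetI)
      fix w assume "w \<in> (\<lambda>(Rs, Cs). block_word Rs Cs) ` genocchi_block_seqs n"
      then show "w \<in> {w \<in> permutations_of_set {1..2 * n + 1}. alternating_word w}"
        using alternating_word_block_word by (auto simp: genocchi_block_seqs_iff)
    next
      fix w assume w: "w \<in> {w \<in> permutations_of_set {1..2 * n + 1}. alternating_word w}"
      then obtain Rs Cs where "block_chain Rs Cs" "block_word Rs Cs = w"
        using ex_block_word by blast
      then show "w \<in> (\<lambda>(Rs, Cs). block_word Rs Cs) ` genocchi_block_seqs n"
        using w by (intro image_eqI[of _ _ "(Rs, Cs)"]) (auto simp: genocchi_block_seqs_iff)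
    qed
  qed
qed

section \<open>Genocchi permutations and block sequences as tours\<close>

lemma snoc_permutation_iff:
  fixes n :: nat
  shows "v @ [2 * n + 1] \<in> permutations_of_set {1..2 * n + 1} \<longleftrightarrow> v \<in> permutations_of_set {1..2 * n}"
proof -
  have ins: "{1..2 * n + 1} = insert (2 * n + 1) {1..2 * n}" by auto
  have new: "2 * n + 1 \<notin> {1..2 * n}" by simp
  have "insert (2 * n + 1) (set v) = insert (2 * n + 1) {1..2 * n} \<longleftrightarrow> set v = {1..2 * n}"
    if "2 * n + 1 \<notin> set v"
    using insert_ident[OF that new] .
  then show ?thesis
    unfolding permutations_of_set_def ins using new by auto
qed

text \<open>The letter \<open>2n + 1\<close> is odd and larger than all others, so it cannot be followed by anything and
  must come last. In front of the word it acts as an even letter, being outside \<open>A\<close>: from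
  there only a drop to an odd letter is possible, so the first letter is odd.\<close>

lemma alternating_words_eq_snoc_tours:
  assumes "n \<ge> 1"
  shows "{w \<in> permutations_of_set {1..2 * n + 1}. alternating_word w} =
    (\<lambda>v. v @ [2 * n + 1]) ` tours (2 * n + 1) {1..2 * n}
      (ascent_or_drop {k \<in> {1..2 * n}. odd k} {k \<in> {1..2 * n}. odd k})"
    (is "?W = ?f ` tours ?N ?S (ascent_or_drop ?A ?A)")
proof -
  let ?Q = "\<lambda>x y :: nat. x < y \<or> even x \<and> odd y"
  have iff: "alternating_word (v @ [?N]) \<longleftrightarrow>
      successively (ascent_or_drop ?A ?A) (?N # v @ [?N])"
    if "v \<in> permutations_of_set ?S" for v
  proof -
    have v: "set v = ?S" using that by (simp add: permutations_of_set_def)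
    then have ne: "v \<noteq> []" using assms by auto
    have hl: "hd v \<in> ?S" "last v \<in> ?S" using ne v hd_in_set last_in_set by blast+
    have "successively ?Q v \<longleftrightarrow> successively (ascent_or_drop ?A ?A) v"
      by (rule successively_cong) (use v in \<open>auto simp: ascent_or_drop_def\<close>)
    then show ?thesis
      using ne hl
      by (auto simp: alternating_word_def successively_append_iff successively_Cons
          ascent_or_drop_def)
  qed
  have last: "w \<in> ?f ` permutations_of_set ?S" if "w \<in> ?W" for w
  proof -
    have w: "w \<in> permutations_of_set {1..?N}" "successively ?Q w"
      using that by (auto simp: alternating_word_def)
    obtain us vs where s: "w = us @ ?N # vs" "set us \<union> set vs = {1..?N} - {?N}"
      using w(1) by (rule split_at_letter[of _ _ ?N]) auto
    have "vs = []"
    proof (rule ccontr)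
      assume ne: "vs \<noteq> []"
      then have "?N < hd vs"
        using w(2) unfolding s(1) by (auto simp: successively_append_iff successively_Cons)
      moreover have "hd vs \<in> {1..?N}" using s(2) hd_in_set[OF ne] by blast
      ultimately show False by simp
    qed
    then show ?thesis using s w(1) snoc_permutation_iff by blast
  qed
  show ?thesis
  proof (intro equalityI subsetI)
    fix w assume w: "w \<in> ?W"
    then obtain v where "w = v @ [?N]" "v \<in> permutations_of_set ?S" using last by blast
    then show "w \<in> ?f ` tours ?N ?S (ascent_or_drop ?A ?A)"
      using w iff by (auto simp: tours_def)
  next
    fix w assume "w \<in> ?f ` tours ?N ?S (ascent_or_drop ?A ?A)"
    then obtain v where v: "w = v @ [?N]" "v \<in> permutations_of_set ?S"
      "successively (ascent_or_drop ?A ?A) (?N # v @ [?N])"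
      unfolding tours_def by blast
    then show "w \<in> ?W" using iff[OF v(2)] snoc_permutation_iff[of v n] by blast
  qed
qed

text \<open>Every letter but the last is either an ascent bottom or a descent top, so prescribing both sets
  amounts to prescribing, for every step, whether it goes up.\<close>

lemma ascent_descent_sets_iff:
  fixes xs :: "nat list"
  assumes "distinct xs" "xs \<noteq> []"
  shows "ascent_bottoms xs = A \<and> descent_tops xs = B \<longleftrightarrow>
    successively (ascends_exactly_from A) xs \<and> A \<inter> B = {} \<and> A \<union> B = set (butlast xs)"
    (is "?L \<longleftrightarrow> ?R")
proof -
  have neq: "xs ! i \<noteq> xs ! Suc i" if "Suc i < length xs" for i
    using that assms by (simp add: nth_eq_iff_index_eq)
  have disj: "ascent_bottoms xs \<inter> descent_tops xs = {}"
    using assms by (auto simp: ascent_bottoms_def descent_tops_def nth_eq_iff_index_eq)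
  have "set (butlast xs) = {butlast xs ! i |i. Suc i < length xs}"
    by (simp add: set_conv_nth less_diff_conv)
  also have "\<dots> = {xs ! i |i. Suc i < length xs}"
    by (rule Collect_cong, rule iff_exI) (auto simp: nth_butlast)
  finally have bl: "set (butlast xs) = {xs ! i |i. Suc i < length xs}" .
  have un: "ascent_bottoms xs \<union> descent_tops xs = set (butlast xs)"
    unfolding bl ascent_bottoms_def descent_tops_def using neq by (auto simp: neq_iff)
  have "successively (ascends_exactly_from (ascent_bottoms xs)) xs"
    unfolding successively_conv_nth ascends_exactly_from_def ascent_bottoms_def
    using assms by (auto simp: nth_eq_iff_index_eq)
  moreover have "A = ascent_bottoms xs"
    if "successively (ascends_exactly_from A) xs" "A \<subseteq> set (butlast xs)"
    using that unfolding successively_conv_nth ascends_exactly_from_def ascent_bottoms_def bl by fastforce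
  ultimately show ?thesis using disj un by blast
qed

text \<open>The copy of \<open>2n + 1\<close> in front imposes nothing here, as every step from it goes down and it is
  outside \<open>A\<close>.\<close>

lemma genocchi_perms_eq_snoc_tours:
  assumes "n \<ge> 1"
  shows "genocchi_perms n = (\<lambda>v. v @ [2 * n + 1]) ` tours (2 * n + 1) {1..2 * n}
      (ascends_exactly_from {k \<in> {1..2 * n}. odd k})"
    (is "_ = ?f ` tours ?N ?S (ascends_exactly_from ?A)")
proof -
  have iff: "v @ [?N] \<in> genocchi_perms n \<longleftrightarrow> v \<in> tours ?N ?S (ascends_exactly_from ?A)" for v
  proof (cases "v \<in> permutations_of_set ?S")
    case True
    then have v: "set v = ?S" by (simp add: permutations_of_set_def)
    then have ne: "v \<noteq> []" using assms by auto
    then have "hd v < ?N" using v hd_in_set[of v] by auto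
    then have cyc: "successively (ascends_exactly_from ?A) (?N # v @ [?N]) \<longleftrightarrow>
        successively (ascends_exactly_from ?A) (v @ [?N])"
      using ne by (simp add: successively_Cons ascends_exactly_from_def)
    have p: "v @ [?N] \<in> permutations_of_set {1..?N}" using True snoc_permutation_iff by blast
    then have d: "distinct (v @ [?N])" by (simp only: permutations_of_set_def mem_Collect_eq)
    have "?A \<inter> {k \<in> ?S. even k} = {}" "?A \<union> {k \<in> ?S. even k} = set (butlast (v @ [?N]))"
      unfolding butlast_snoc v by blast+
    then have "ascent_bottoms (v @ [?N]) = ?A \<and> descent_tops (v @ [?N]) = {k \<in> ?S. even k} \<longleftrightarrow>
        successively (ascends_exactly_from ?A) (v @ [?N])"
      using ascent_descent_sets_iff[OF d, of ?A "{k \<in> ?S. even k}"] by blast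
    moreover have "v @ [?N] \<in> genocchi_perms n \<longleftrightarrow>
        ascent_bottoms (v @ [?N]) = ?A \<and> descent_tops (v @ [?N]) = {k \<in> ?S. even k}"
      unfolding genocchi_perms_def mem_Collect_eq using p by (simp only: last_snoc simp_thms)
    ultimately show ?thesis
      unfolding tours_def mem_Collect_eq using True cyc by blast
  next
    case False
    then have "v @ [?N] \<notin> permutations_of_set {1..?N}" using snoc_permutation_iff by blast
    then show ?thesis using False unfolding genocchi_perms_def tours_def by blast
  qed
  show ?thesis
  proof (intro equalityI subsetI)
    fix w assume w: "w \<in> genocchi_perms n"
    then have "last w = ?N" "w \<noteq> []"
      by (auto simp: genocchi_perms_def permutations_of_set_def)
    then obtain v where "w = v @ [?N]" by (metis append_butlast_last_id)
    then show "w \<in> ?f ` tours ?N ?S (ascends_exactly_from ?A)" using w iff by blast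
  next
    fix w assume "w \<in> ?f ` tours ?N ?S (ascends_exactly_from ?A)"
    then show "w \<in> genocchi_perms n" using iff by auto
  qed
qed

theorem theorem19:
  fixes n :: nat
  assumes "n \<ge> 1"
  shows "unsigned_genocchi n = card (genocchi_block_seqs n)"
proof -
  let ?A = "{k \<in> {1..2 * n}. odd k}" and ?N = "2 * n + 1"
  have inj: "inj_on (\<lambda>v. v @ [?N]) X" for X by (rule inj_onI) simp
  have "unsigned_genocchi n = card (tours ?N {1..2 * n} (ascends_exactly_from ?A))"
    unfolding unsigned_genocchi_def genocchi_perms_eq_snoc_tours[OF assms]
    by (rule card_image[OF inj])
  also have "\<dots> = card (tours ?N {1..2 * n} (ascent_or_drop ?A ?A))"
    by (rule card_tours_ascends_exactly_from_eq) (use assms in auto)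
  also have "\<dots> = card (genocchi_block_seqs n)"
    unfolding card_genocchi_block_seqs alternating_words_eq_snoc_tours[OF assms]
    by (rule card_image[OF inj, symmetric])
  finally show ?thesis .
qed

end
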